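(* Let $q$ be a permutation of length $m$ which is indecomposable and can be written as $q = q_1 \ominus q_2 \ominus \cdots \ominus q_k$ for some $k \geq 2$, where each $q_i$ is skew-indecomposable and none of $q_2, \ldots, q_{k-1}$ is the permutation $1$ of length one. Let $\ell$ be the length of $q_1$, and let $r \geq 1$. Then for $n \geq rm$ there is an injection \[ \phi: \mathcal{I}_{n-rm-\ell+1,\, r} \times S_{n-rm-\ell}(q) \hookrightarrow S_{n,r}(q). \]
   Context: A permutation $p$ contains an occurrence (copy) of a pattern $q = q_1\cdots q_k$ if there are indices $n_1 < \cdots < n_k$ with $p_{n_i} < p_{n_j}$ if and only if $q_i < q_j$; distinct index sequences count as distinct copies. $S_n(q)$ is the set of permutations of length $n$ with no copy of $q$, and $S_{n,r}(q)$ is the set of permutations of length $n$ with exactly $r$ copies of $q$. For $n \geq k$, $\mathcal{I}_{n,k}$ denotes the set of $k$-element subsets of $[n]=\{1,\ldots,n\}$. For permutations $\alpha$ of length $a$ and $\beta$ of length $b$, the direct sum $\alpha\oplus\beta$ is the permutation of length $a+b$ given by $\alpha$ followed by $\beta$ with all values of $\beta$ increased by $a$; the skew sum $\alpha\ominus\beta$ is $\alpha$ with all values increased by $b$ followed by $\beta$. A permutation is indecomposable if it is not a direct sum of two nonempty permutations, and skew-indecomposable if it is not a skew sum of two nonempty permutations. *)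

theory Defs
  imports Main "HOL-Combinatorics.Multiset_Permutations"
begin

text \<open>Permutations of length \<open>n\<close> are written in one-line notation, as lists that enumerate
  \<open>{1..n}\<close>; list positions are counted from 0.\<close>

definition perms :: "nat \<Rightarrow> nat list set" where
  "perms n = permutations_of_set {1..n}"

definition is_perm :: "nat list \<Rightarrow> bool" where
  "is_perm p \<longleftrightarrow> p \<in> perms (length p)"

definition copies :: "nat list \<Rightarrow> nat list \<Rightarrow> nat list set" where
  "copies q p = {ns. length ns = length q \<and> sorted_wrt (<) ns \<and> set ns \<subseteq> {..<length p} \<and>
     (\<forall>i<length q. \<forall>j<length q. p ! (ns ! i) < p ! (ns ! j) \<longleftrightarrow> q ! i < q ! j)}"

text \<open>The lengths below are integers so that a difference of lengths that happens to be negative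
  yields the empty set instead of being truncated to 0.\<close>

definition avoiders :: "int \<Rightarrow> nat list \<Rightarrow> nat list set" where
  "avoiders n q = {p. is_perm p \<and> int (length p) = n \<and> copies q p = {}}"

definition perms_with_copies :: "int \<Rightarrow> nat \<Rightarrow> nat list \<Rightarrow> nat list set" where
  "perms_with_copies n r q = {p. is_perm p \<and> int (length p) = n \<and> card (copies q p) = r}"

definition ksubsets :: "int \<Rightarrow> nat \<Rightarrow> int set set" where
  "ksubsets n k = {A. A \<subseteq> {1..n} \<and> card A = k}"

definition direct_sum :: "nat list \<Rightarrow> nat list \<Rightarrow> nat list" where
  "direct_sum a b = a @ map (\<lambda>x. x + length a) b"

definition skew_sum :: "nat list \<Rightarrow> nat list \<Rightarrow> nat list" where
  "skew_sum a b = map (\<lambda>x. x + length b) a @ b"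

definition indecomposable :: "nat list \<Rightarrow> bool" where
  "indecomposable p \<longleftrightarrow>
     \<not> (\<exists>a b. is_perm a \<and> is_perm b \<and> a \<noteq> [] \<and> b \<noteq> [] \<and> p = direct_sum a b)"

definition skew_indecomposable :: "nat list \<Rightarrow> bool" where
  "skew_indecomposable p \<longleftrightarrow>
     \<not> (\<exists>a b. is_perm a \<and> is_perm b \<and> a \<noteq> [] \<and> b \<noteq> [] \<and> p = skew_sum a b)"

text \<open>The skew sum is associative with the empty permutation as neutral element.\<close>

definition skew_sum_list :: "nat list list \<Rightarrow> nat list" where
  "skew_sum_list qs = foldr skew_sum qs []"

end

theory Submission imports Defs begin

text \<open>Let \<open>w\<close> be a permutation and \<open>x\<close> a gap between positions such that all copies of \<open>q\<close> lie to
  the left of \<open>x\<close>. Let \<open>H\<^sub>j\<close> be the least height such that no copy of \<open>q\<^sub>1 \<ominus> \<dots> \<ominus> q\<^sub>j\<close> lies to the left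
  of \<open>x\<close> and above \<open>H\<^sub>j\<close>; then no copy of \<open>q\<^sub>j\<^sub>+\<^sub>1 \<ominus> \<dots> \<ominus> q\<^sub>k\<close> lies to the right of \<open>x\<close> and below \<open>H\<^sub>j\<close>.
  Insert the entries of \<open>q\<close> contiguously at \<open>x\<close>, cut by value into levels \<open>1, \<dots>, k - 1\<close>, with level
  \<open>j\<close> placed at height \<open>H\<^sub>j\<close>. If a copy of \<open>q\<close> meets the inserted entries exactly in its blocks
  \<open>c, \<dots>, d\<close> (the extreme ones perhaps partially), then only the levels \<open>c, \<dots>, d - 1\<close> are available,
  and fewer if an extreme block is met only partially. Counting entries shows that the copy consists
  of the inserted entries. So each insertion creates exactly one copy, which reveals the gap.
  Doing this at \<open>r\<close> gaps of an avoider from left to right gives the injection; the remaining \<open>\<ell>\<close>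
  entries are padding, added as maxima at the right end.\<close>

section \<open>Permutations in one-line notation\<close>

lemma perms_iff: "p \<in> perms n \<longleftrightarrow> length p = n \<and> distinct p \<and> set p = {1..n}"
  unfolding perms_def permutations_of_set_def
  by (auto simp: distinct_card[symmetric])

lemma is_perm_iff: "is_perm p \<longleftrightarrow> distinct p \<and> set p = {1..length p}"
  by (auto simp: is_perm_def perms_iff)

lemma is_permI:
  assumes "distinct p" "set p \<subseteq> {1..length p}"
  shows "is_perm p"
proof -
  have "set p = {1..length p}"
    by (rule card_subset_eq) (use assms in \<open>auto simp: distinct_card\<close>)
  with assms show ?thesis by (simp add: is_perm_iff)
qed

lemma is_perm_nth:
  assumes "is_perm w" "i < length w"
  shows "1 \<le> w ! i" "w ! i \<le> length w"
  using assms nth_mem[of i w] by (auto simp: is_perm_iff)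

text \<open>The positions with smaller entries correspond bijectively to the values
  \<open>1, ..., w ! i - 1\<close>. So the order comparisons between positions determine the
  permutation.\<close>

lemma is_perm_nth_eq_rank:
  assumes "is_perm w" "i < length w"
  shows "w ! i = Suc (card {j. j < length w \<and> w ! j < w ! i})"
proof -
  let ?S = "{j. j < length w \<and> w ! j < w ! i}"
  have inj: "inj_on ((!) w) ?S"
    using assms(1) by (auto simp: is_perm_iff inj_on_def nth_eq_iff_index_eq)
  have "(!) w ` ?S = {1..<w ! i}"
  proof (intro equalityI subsetI)
    fix v assume "v \<in> (!) w ` ?S"
    then show "v \<in> {1..<w ! i}" using is_perm_nth[OF assms(1)] by auto
  next
    fix v assume v: "v \<in> {1..<w ! i}"
    then have "v \<in> set w" using is_perm_nth[OF assms] assms(1) by (auto simp: is_perm_iff)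
    then show "v \<in> (!) w ` ?S" using v by (auto simp: in_set_conv_nth)
  qed
  then have "card ?S = w ! i - 1" using card_image[OF inj] by simp
  then show ?thesis using is_perm_nth[OF assms] by simp
qed

lemma is_perm_eqI:
  assumes "is_perm w" "is_perm w'" "length w = length w'"
    and "\<And>i j. i < length w \<Longrightarrow> j < length w \<Longrightarrow> w ! i < w ! j \<longleftrightarrow> w' ! i < w' ! j"
  shows "w = w'"
proof (rule nth_equalityI)
  fix i assume i: "i < length w"
  have "{j. j < length w \<and> w ! j < w ! i} = {j. j < length w' \<and> w' ! j < w' ! i}"
    using assms(3,4) i by auto
  then show "w ! i = w' ! i"
    using is_perm_nth_eq_rank[OF assms(1) i] is_perm_nth_eq_rank[OF assms(2)] i assms(3) by metis
qed (rule assms(3))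


section \<open>Embeddings of partial patterns\<close>

text \<open>Positions of \<open>q\<close> keep their numbers, so prefixes and suffixes of a pattern
  need no standardization, and restricting an embedding only shrinks \<open>S\<close>.\<close>

definition embeds :: "nat list \<Rightarrow> nat list \<Rightarrow> nat set \<Rightarrow> (nat \<Rightarrow> nat) \<Rightarrow> bool" where
  "embeds q w S f \<longleftrightarrow> (\<forall>i\<in>S. f i < length w) \<and> (\<forall>i\<in>S. \<forall>j\<in>S. i < j \<longrightarrow> f i < f j) \<and>
     (\<forall>i\<in>S. \<forall>j\<in>S. w ! f i < w ! f j \<longleftrightarrow> q ! i < q ! j)"

lemma embeds_subset: "embeds q w S f \<Longrightarrow> T \<subseteq> S \<Longrightarrow> embeds q w T f"
  unfolding embeds_def by blast

lemma copies_iff_embeds: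
  "ns \<in> copies q w \<longleftrightarrow> length ns = length q \<and> embeds q w {..<length q} ((!) ns)"
proof (cases "length ns = length q")
  case True
  have "set ns \<subseteq> {..<length w} \<longleftrightarrow> (\<forall>i\<in>{..<length q}. ns ! i < length w)"
    by (auto simp: set_conv_nth True)
  moreover have "sorted_wrt (<) ns \<longleftrightarrow> (\<forall>i\<in>{..<length q}. \<forall>j\<in>{..<length q}. i < j \<longrightarrow> ns ! i < ns ! j)"
    by (auto simp: sorted_wrt_iff_nth_less True)
  ultimately show ?thesis by (simp add: copies_def embeds_def True Ball_def conj_ac)
qed (simp add: copies_def)

lemma embeds_imp_copy:
  assumes "embeds q w {..<length q} f"
  shows "map f [0..<length q] \<in> copies q w"
  using assms unfolding copies_iff_embeds embeds_def by auto

lemma finite_copies: "finite (copies q w)"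
proof (rule finite_subset)
  show "copies q w \<subseteq> {ns. set ns \<subseteq> {..<length w} \<and> length ns = length q}"
    by (auto simp: copies_def)
qed (simp add: finite_lists_length_eq)


section \<open>Inserting a pattern with prescribed heights\<close>

text \<open>\<open>Y t\<close> is the number of old values below the inserted entry \<open>t\<close>; for this to be consistent,
  \<open>Y\<close> has to be nondecreasing.\<close>

definition lift :: "nat \<Rightarrow> (nat \<Rightarrow> nat) \<Rightarrow> nat \<Rightarrow> nat" where
  "lift m Y v = v + card {t \<in> {1..m}. Y t < v}"

definition insert_pattern :: "nat list \<Rightarrow> (nat \<Rightarrow> nat) \<Rightarrow> nat list \<Rightarrow> nat \<Rightarrow> nat list" where
  "insert_pattern q Y w x =
     map (lift (length q) Y) (take x w) @ map (\<lambda>t. t + Y t) q @ map (lift (length q) Y) (drop x w)"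

lemma length_insert_pattern [simp]: "length (insert_pattern q Y w x) = length w + length q"
  by (simp add: insert_pattern_def)

lemma nth_insert_pattern:
  assumes "x \<le> length w"
  shows "i < x \<Longrightarrow> insert_pattern q Y w x ! i = lift (length q) Y (w ! i)"
    and "i < length q \<Longrightarrow> insert_pattern q Y w x ! (x + i) = q ! i + Y (q ! i)"
    and "x + length q \<le> i \<Longrightarrow> i < length w + length q \<Longrightarrow>
      insert_pattern q Y w x ! i = lift (length q) Y (w ! (i - length q))"
  using assms by (auto simp: insert_pattern_def nth_append)

lemma lift_strict_mono: "v < v' \<Longrightarrow> lift m Y v < lift m Y v'"
  unfolding lift_def by (intro add_less_le_mono card_mono) auto

lemma lift_less_iff: "lift m Y v < lift m Y v' \<longleftrightarrow> v < v'"
  by (metis lift_strict_mono linorder_neqE_nat order_less_asym)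

lemma lift_eq_iff: "lift m Y v = lift m Y v' \<longleftrightarrow> v = v'"
  by (metis lift_strict_mono linorder_neqE_nat order_less_irrefl)

context
  fixes m :: nat and Y :: "nat \<Rightarrow> nat"
  assumes mono_Y: "\<And>t t'. 1 \<le> t \<Longrightarrow> t \<le> t' \<Longrightarrow> t' \<le> m \<Longrightarrow> Y t \<le> Y t'"
begin

text \<open>By monotonicity, \<open>Y t' < v\<close> and \<open>v \<le> Y t\<close> force
  \<open>t' < t\<close>. So at most \<open>t - 1\<close> inserted entries push \<open>v\<close>
  up.\<close>

lemma lift_below:
  assumes "1 \<le> t" "t \<le> m" "v \<le> Y t"
  shows "lift m Y v < t + Y t"
proof -
  have "t' < t" if "t' \<le> m" "Y t' < v" for t'
    using mono_Y[of t t'] that assms by (meson leD le_trans not_less)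
  then have "{t \<in> {1..m}. Y t < v} \<subseteq> {1..<t}" by auto
  then have "card {t \<in> {1..m}. Y t < v} \<le> t - 1" using card_mono[of "{1..<t}"] by fastforce
  then show ?thesis using assms by (simp add: lift_def)
qed

lemma lift_above:
  assumes "1 \<le> t" "t \<le> m" "Y t < v"
  shows "t + Y t < lift m Y v"
proof -
  have "Y t' < v" if "1 \<le> t'" "t' \<le> t" for t'
    using mono_Y[of t' t] that assms by (meson le_less_trans)
  then have "{1..t} \<subseteq> {t \<in> {1..m}. Y t < v}" using assms by auto
  then have "t \<le> card {t \<in> {1..m}. Y t < v}"
    using card_mono[of "{t \<in> {1..m}. Y t < v}" "{1..t}"] by fastforce
  then show ?thesis using assms by (simp add: lift_def)
qed

lemma lift_less_inserted_iff:
  assumes "1 \<le> t" "t \<le> m"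
  shows "lift m Y v < t + Y t \<longleftrightarrow> v \<le> Y t" "t + Y t < lift m Y v \<longleftrightarrow> Y t < v"
    "lift m Y v \<noteq> t + Y t"
  using lift_below[OF assms, of v] lift_above[OF assms, of v] by linarith+

lemma inserted_less_iff:
  assumes "1 \<le> t" "t \<le> m" "1 \<le> t'" "t' \<le> m"
  shows "t + Y t < t' + Y t' \<longleftrightarrow> t < t'"
proof (cases "t \<le> t'")
  case True then show ?thesis using mono_Y[of t t'] assms by (cases "t = t'") auto
next
  case False then show ?thesis using mono_Y[of t' t] assms by auto
qed

lemma is_perm_insert_pattern:
  assumes q: "q \<in> perms m" and w: "is_perm w" and x: "x \<le> length w"
    and Y_le: "\<And>t. Y t \<le> length w"
  shows "is_perm (insert_pattern q Y w x)"
proof (rule is_permI)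
  have lq: "length q = m" "distinct q" "set q = {1..m}" using q by (auto simp: perms_iff)
  have dw: "distinct w" "set w = {1..length w}" using w by (auto simp: is_perm_iff)
  have "distinct (take x w @ drop x w)" using dw(1) by simp
  then have disj: "set (take x w) \<inter> set (drop x w) = {}" unfolding distinct_append by simp
  have ne: "lift m Y v \<noteq> t + Y t" if "t \<in> set q" for v t
    using lift_less_inserted_iff(3)[of t v] that lq by auto
  have injY: "inj_on (\<lambda>t. t + Y t) (set q)"
  proof (rule inj_onI)
    fix t t' assume "t \<in> set q" "t' \<in> set q" "t + Y t = t' + Y t'"
    then show "t = t'"
      using inserted_less_iff[of t t'] inserted_less_iff[of t' t] lq by fastforce
  qed
  show "distinct (insert_pattern q Y w x)"
    unfolding insert_pattern_def lq(1)
    using disj dw(1) lq(2) injY ne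
    by (auto simp: distinct_map lift_eq_iff inj_on_def) (metis ne)+
  have "lift m Y v \<in> {1..length w + m}" if "v \<in> set w" for v
  proof -
    have "card {t \<in> {1..m}. Y t < v} \<le> card {1..m}" by (rule card_mono) auto
    moreover have "1 \<le> v" "v \<le> length w" using that dw by auto
    ultimately show ?thesis by (simp add: lift_def)
  qed
  moreover have "t + Y t \<in> {1..length w + m}" if "t \<in> set q" for t
    using that lq Y_le[of t] by auto
  ultimately show "set (insert_pattern q Y w x) \<subseteq> {1..length (insert_pattern q Y w x)}"
    unfolding length_insert_pattern lq(1)
    by (auto simp: insert_pattern_def lq(1) dest!: in_set_takeD in_set_dropD)
qed

end

text \<open>Outside the window of inserted entries, the positions \<open>g i\<close> carry the
  relative order of \<open>w\<close>, whatever the heights are; that order determines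
  \<open>w\<close>.\<close>

lemma insert_pattern_inject:
  assumes eq: "insert_pattern q Y w x = insert_pattern q Y' w' x"
    and w: "is_perm w" and w': "is_perm w'" and x: "x \<le> length w"
  shows "w = w'"
proof -
  have len: "length w = length w'"
    using arg_cong[OF eq, of length] by simp
  define g where "g = (\<lambda>i. if i < x then i else i + length q)"
  have g: "insert_pattern q Y w x ! g i = lift (length q) Y (w ! i)"
    "insert_pattern q Y' w' x ! g i = lift (length q) Y' (w' ! i)" if "i < length w" for i
    using that x len by (simp_all add: g_def nth_insert_pattern)
  show ?thesis
  proof (rule is_perm_eqI[OF w w' len])
    fix i j assume "i < length w" "j < length w"
    then show "w ! i < w ! j \<longleftrightarrow> w' ! i < w' ! j"
      using g[of i] g[of j] eq lift_less_iff by metis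
  qed
qed


section \<open>Patterns cut into skew blocks\<close>

text \<open>Blocks are numbered from 0, and block \<open>j\<close> occupies the positions from
  \<open>P j\<close> up to \<open>P (Suc j) - 1\<close>. Skew-indecomposability enters as
  \<open>block_ascent\<close>: each way to split a block in two is crossed by an ascent.\<close>

locale skew_blocks =
  fixes q :: "nat list" and m k :: nat and P :: "nat \<Rightarrow> nat"
  assumes q_perm: "q \<in> perms m"
    and k_ge_2: "k \<ge> 2"
    and P_0: "P 0 = 0"
    and P_k: "P k = m"
    and P_strict_mono: "\<And>i j. i < j \<Longrightarrow> j \<le> k \<Longrightarrow> P i < P j"
    and cut: "\<And>j i i'. j \<le> k \<Longrightarrow> i < P j \<Longrightarrow> P j \<le> i' \<Longrightarrow> i' < m \<Longrightarrow> q ! i' < q ! i"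
    and block_ascent: "\<And>j s. j < k \<Longrightarrow> P j < s \<Longrightarrow> s < P (Suc j) \<Longrightarrow>
      \<exists>i i'. P j \<le> i \<and> i < s \<and> s \<le> i' \<and> i' < P (Suc j) \<and> q ! i < q ! i'"
    and middle_size: "\<And>j. 1 \<le> j \<Longrightarrow> j < k - 1 \<Longrightarrow> P j + 2 \<le> P (Suc j)"
begin

lemma q_facts: "length q = m" "distinct q" "set q = {1..m}"
  using q_perm by (auto simp: perms_iff)

lemma q_nth: "i < m \<Longrightarrow> 1 \<le> q ! i" "i < m \<Longrightarrow> q ! i \<le> m"
  using q_facts nth_mem[of i q] by auto

lemma P_mono: "i \<le> j \<Longrightarrow> j \<le> k \<Longrightarrow> P i \<le> P j"
  using P_strict_mono[of i j] by (cases "i = j") auto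

lemma P_less_m: "i < k \<Longrightarrow> P i < m"
  using P_strict_mono[of i k] P_k by auto

lemma P_pos: "1 \<le> i \<Longrightarrow> i \<le> k \<Longrightarrow> 0 < P i"
  using P_strict_mono[of 0 i] P_0 by auto

lemma m_pos: "0 < m"
  using P_less_m[of 0] k_ge_2 by simp

lemma exists_block:
  assumes "i < m"
  obtains c where "c < k" "P c \<le> i" "i < P (Suc c)"
proof -
  define c where "c = (LEAST c. i < P (Suc c))"
  have ex: "i < P (Suc (k - 1))" using assms P_k k_ge_2 by simp
  have 1: "i < P (Suc c)" unfolding c_def by (rule LeastI[of "\<lambda>c. i < P (Suc c)", OF ex])
  have 2: "c \<le> k - 1" unfolding c_def by (rule Least_le[of "\<lambda>c. i < P (Suc c)", OF ex])
  have "P c \<le> i"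
  proof (cases c)
    case (Suc c')
    then show ?thesis using not_less_Least[of c' "\<lambda>c. i < P (Suc c)"] by (simp add: c_def[symmetric])
  qed (simp add: P_0)
  then show thesis using that[of c] 1 2 k_ge_2 by auto
qed

text \<open>The values of \<open>q\<close> are split into levels \<open>1, \<dots>, k - 1\<close> from top to bottom. The level
  boundaries are shifted against the block boundaries, so that each level but the last takes the
  topmost entry of the following block. This is possible as the middle blocks are not singletons,
  and it is why a proper range of levels is too small to hold the corresponding blocks.\<close>

definition level :: "nat \<Rightarrow> nat" where
  "level t = (LEAST j. 1 \<le> j \<and> (m - t \<le> P j \<or> j = k - 1))"

lemma level_props:
  "1 \<le> level t" "level t \<le> k - 1" "m - t \<le> P (level t) \<or> level t = k - 1"
proof -
  let ?Q = "\<lambda>j. 1 \<le> j \<and> (m - t \<le> P j \<or> j = k - 1)"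
  have ex: "?Q (k - 1)" using k_ge_2 by simp
  show "level t \<le> k - 1" unfolding level_def by (rule Least_le[of ?Q, OF ex])
  have "?Q (level t)" unfolding level_def by (rule LeastI[of ?Q, OF ex])
  then show "1 \<le> level t" "m - t \<le> P (level t) \<or> level t = k - 1" by auto
qed

lemma level_antimono: "t \<le> t' \<Longrightarrow> level t' \<le> level t"
  unfolding level_def[of t'] using level_props[of t] by (intro Least_le) auto

text \<open>The number of values of \<open>q\<close> above \<open>t\<close> is \<open>m - t\<close>,
  its rank from the top. Rank \<open>P c\<close> still belongs to level \<open>c\<close>, whence the
  strict bound. For \<open>c = 0\<close> there is no such level and only the weak bound below
  remains.\<close>

lemma level_gt_imp: "c < level t \<Longrightarrow> 1 \<le> c \<Longrightarrow> P c < m - t"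
  using not_less_Least[of c "\<lambda>j. 1 \<le> j \<and> (m - t \<le> P j \<or> j = k - 1)"]
  unfolding level_def[symmetric] by auto

lemma level_gt_imp_weak: "c < level t \<Longrightarrow> P c \<le> m - t"
  using level_gt_imp[of c t] P_0 by (cases "c = 0") auto

lemma level_le_imp:
  assumes "level t \<le> e" "e < k - 1"
  shows "m - t \<le> P e"
  using level_props(3)[of t] P_mono[of "level t" e] assms by linarith

section \<open>Heights and the insertion of one copy\<close>

definition height :: "nat list \<Rightarrow> nat \<Rightarrow> nat \<Rightarrow> nat" where
  "height w x a = (LEAST y. \<not> (\<exists>f. embeds q w {..<a} f \<and> (\<forall>i<a. f i < x \<and> y < w ! f i)))"

definition insert_copy :: "nat list \<Rightarrow> nat \<Rightarrow> nat list" where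
  "insert_copy w x = insert_pattern q (\<lambda>t. height w x (P (level t))) w x"

lemma length_insert_copy [simp]: "length (insert_copy w x) = length w + m"
  by (simp add: insert_copy_def q_facts)

context
  fixes w :: "nat list" and x :: nat
  assumes w: "is_perm w" and x: "x \<le> length w"
begin

abbreviation H :: "nat \<Rightarrow> nat" where "H \<equiv> height w x"
abbreviation Y :: "nat \<Rightarrow> nat" where "Y t \<equiv> H (P (level t))"

text \<open>This makes the \<open>LEAST\<close> in \<open>height\<close> meaningful for
  \<open>0 < a\<close>. For \<open>a = 0\<close> the empty embedding exists above every
  \<open>y\<close>, so that height is unspecified.\<close>

lemma no_embedding_above_length:
  assumes "0 < a"
  shows "\<not> (\<exists>f :: nat \<Rightarrow> nat. embeds q w {..<a} f \<and> (\<forall>i<a. f i < x \<and> length w < w ! f i))"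
proof
  assume "\<exists>f. embeds q w {..<a} f \<and> (\<forall>i<a. f i < x \<and> length w < w ! f i)"
  then obtain f :: "nat \<Rightarrow> nat" where "f 0 < x" "length w < w ! f 0" using assms by blast
  then show False using is_perm_nth(2)[OF w, of "f 0"] x by simp
qed

lemma height_le: "0 < a \<Longrightarrow> H a \<le> length w"
  unfolding height_def by (rule Least_le) (rule no_embedding_above_length)

lemma height_left:
  assumes "0 < a" "embeds q w {..<a} f" "\<And>i. i < a \<Longrightarrow> f i < x"
  obtains i where "i < a" "w ! f i \<le> H a"
proof -
  have "\<not> (\<exists>f. embeds q w {..<a} f \<and> (\<forall>i<a. f i < x \<and> H a < w ! f i))"
    unfolding height_def by (rule LeastI_ex) (use no_embedding_above_length[OF assms(1)] in blast)
  then show thesis using that assms(2,3) not_less by blast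
qed

text \<open>An embedding of the longer prefix restricts to the shorter one, so a height that
  excludes the shorter prefix excludes the longer one too.\<close>

lemma height_antimono:
  assumes "0 < a" "a \<le> b"
  shows "H b \<le> H a"
  unfolding height_def[of w x b]
proof (rule Least_le, rule notI)
  assume "\<exists>f. embeds q w {..<b} f \<and> (\<forall>i<b. f i < x \<and> H a < w ! f i)"
  then obtain f where f: "embeds q w {..<b} f" "\<forall>i<b. f i < x \<and> H a < w ! f i" by blast
  have "embeds q w {..<a} f" using embeds_subset[OF f(1), of "{..<a}"] assms by auto
  then obtain i where "i < a" "w ! f i \<le> H a" using height_left[OF assms(1)] f(2) assms(2)
    by (metis order_less_le_trans)
  then show False using f(2) assms(2) by (meson leD order_less_le_trans)
qed

text \<open>A larger value has a smaller level, hence a shorter prefix and a height at least as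
  large. This is the consistency that inserting a pattern requires.\<close>

lemma Y_mono: "t \<le> t' \<Longrightarrow> Y t \<le> Y t'"
  using level_antimono[of t t'] level_props[of t] level_props[of t'] k_ge_2
  by (intro height_antimono P_pos P_mono) auto

lemma Y_le: "Y t \<le> length w"
  using level_props[of t] k_ge_2 by (intro height_le P_pos) auto

text \<open>An old value that separates two inserted entries by height thus separates their levels.
  This gains a level whenever an extreme block meets the window only partially.\<close>

lemma Y_less_imp_level: "Y t < Y t' \<Longrightarrow> level t' < level t"
  using height_antimono[OF P_pos P_mono, of "level t" "level t'"] level_props[of t] level_props[of t']
  by (meson diff_le_self le_trans not_less)

lemma is_perm_insert_copy: "is_perm (insert_copy w x)"
  unfolding insert_copy_def
  by (rule is_perm_insert_pattern[OF _ q_perm w x Y_le]) (rule Y_mono)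

lemma nth_insert_copy_left: "i < x \<Longrightarrow> insert_copy w x ! i = lift m Y (w ! i)"
  using nth_insert_pattern(1)[OF x, of i q Y] by (simp add: insert_copy_def q_facts)

lemma nth_insert_copy_inner:
  "x \<le> i \<Longrightarrow> i < x + m \<Longrightarrow> insert_copy w x ! i = q ! (i - x) + Y (q ! (i - x))"
  using nth_insert_pattern(2)[OF x, of "i - x" q Y] by (simp add: insert_copy_def q_facts)

lemma nth_insert_copy_right:
  "x + m \<le> i \<Longrightarrow> i < length w + m \<Longrightarrow> insert_copy w x ! i = lift m Y (w ! (i - m))"
  using nth_insert_pattern(3)[OF x, of q i Y] by (simp add: insert_copy_def q_facts)

lemma lift_less_inner_iff:
  assumes "i < m"
  shows "lift m Y v < q ! i + Y (q ! i) \<longleftrightarrow> v \<le> Y (q ! i)"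
    "q ! i + Y (q ! i) < lift m Y v \<longleftrightarrow> Y (q ! i) < v"
  using lift_less_inserted_iff[of m Y "q ! i" v] q_nth[OF assms] Y_mono by auto

lemma inner_less_iff:
  assumes "i < m" "j < m"
  shows "q ! i + Y (q ! i) < q ! j + Y (q ! j) \<longleftrightarrow> q ! i < q ! j"
  using inserted_less_iff[of m Y "q ! i" "q ! j"] q_nth[OF assms(1)] q_nth[OF assms(2)] Y_mono by auto

lemma embeds_left:
  assumes f: "embeds q (insert_copy w x) S f" and S: "\<And>i. i \<in> S \<Longrightarrow> f i < x"
  shows "embeds q w S f"
proof -
  have nth: "insert_copy w x ! f i = lift m Y (w ! f i)" if "i \<in> S" for i
    using nth_insert_copy_left S that by blast
  have "f i < length w" if "i \<in> S" for i using S[OF that] x by simp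
  then show ?thesis using f nth by (simp add: embeds_def lift_less_iff)
qed

lemma embeds_right:
  assumes f: "embeds q (insert_copy w x) S f" and S: "\<And>i. i \<in> S \<Longrightarrow> x + m \<le> f i"
  shows "embeds q w S (\<lambda>i. f i - m)"
proof -
  have f_lt: "f i < length w + m" if "i \<in> S" for i using f that by (auto simp: embeds_def)
  have nth: "insert_copy w x ! f i = lift m Y (w ! (f i - m))" if "i \<in> S" for i
    using nth_insert_copy_right S f_lt that by blast
  have "f i - m < length w" if "i \<in> S" for i
    using f_lt[OF that] S[OF that] by linarith
  moreover have "f i - m < f j - m" if "i \<in> S" "j \<in> S" "i < j" for i j
    using f S[OF that(1)] S[OF that(2)] that unfolding embeds_def by (metis add_leD2 diff_less_mono)
  moreover have "w ! (f i - m) < w ! (f j - m) \<longleftrightarrow> q ! i < q ! j" if "i \<in> S" "j \<in> S" for i j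
    using f nth that unfolding embeds_def by (metis lift_less_iff)
  ultimately show ?thesis unfolding embeds_def by blast
qed

lemma embeds_outside:
  assumes f: "embeds q (insert_copy w x) S f"
    and S: "\<And>i. i \<in> S \<Longrightarrow> f i < x \<or> x + m \<le> f i"
  shows "embeds q w S (\<lambda>i. if f i < x then f i else f i - m)" (is "embeds q w S ?g")
proof -
  have f_lt: "f i < length w + m" if "i \<in> S" for i using f that by (auto simp: embeds_def)
  have nth: "insert_copy w x ! f i = lift m Y (w ! ?g i)" if "i \<in> S" for i
    using nth_insert_copy_left[of "f i"] nth_insert_copy_right[of "f i"] S[OF that] f_lt[OF that]
    by auto
  have "?g i < length w" if "i \<in> S" for i
    using f_lt[OF that] S[OF that] x by auto
  moreover have "?g i < ?g j" if "i \<in> S" "j \<in> S" "i < j" for i j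
  proof -
    have "f i < f j" using f that unfolding embeds_def by blast
    then show ?thesis using S[OF that(1)] S[OF that(2)] by auto
  qed
  moreover have "w ! ?g i < w ! ?g j \<longleftrightarrow> q ! i < q ! j" if "i \<in> S" "j \<in> S" for i j
    using f nth[OF that(1)] nth[OF that(2)] that unfolding embeds_def by (metis lift_less_iff)
  ultimately show ?thesis unfolding embeds_def by blast
qed

section \<open>Copies of the pattern after one insertion\<close>

context
  assumes left: "\<And>ns. ns \<in> copies q w \<Longrightarrow> set ns \<subseteq> {..<x}"
begin

text \<open>By minimality of \<open>H (P j)\<close>, the first \<open>j\<close> blocks embed to the left of \<open>x\<close> with values
  at least \<open>H (P j)\<close>; hence the other blocks cannot embed to the right of \<open>x\<close> and below.\<close>

lemma height_right:
  assumes j: "j < k" and g: "embeds q w {P j..<m} g" "\<And>i. P j \<le> i \<Longrightarrow> i < m \<Longrightarrow> x \<le> g i"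
    and le: "\<And>i. P j \<le> i \<Longrightarrow> i < m \<Longrightarrow> w ! g i \<le> H (P j)"
  shows False
proof -
  have last: "P j \<le> m - 1" "m - 1 < m" using P_less_m[OF j] by auto
  have "g (m - 1) < length w" using g(1) last by (auto simp: embeds_def)
  \<comment> \<open>Values of \<open>w\<close> are at least 1, so the truncated subtraction really
    gives a smaller number, to which minimality of the height applies.\<close>
  then have H_pos: "H (P j) - 1 < H (P j)" using le[OF last] is_perm_nth(1)[OF w] by fastforce
  then have "\<exists>f. embeds q w {..<P j} f \<and> (\<forall>i<P j. f i < x \<and> H (P j) - 1 < w ! f i)"
    unfolding height_def by (rule not_less_Least[THEN notnotD])
  then obtain f where f: "embeds q w {..<P j} f" "\<And>i. i < P j \<Longrightarrow> f i < x"
    "\<And>i. i < P j \<Longrightarrow> H (P j) - 1 < w ! f i" by blast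
  define h where "h = (\<lambda>i. if i < P j then f i else g i)"
  \<comment> \<open>The bounds give only a weak inequality; it is strict because the two positions
    lie on different sides of \<open>x\<close>.\<close>
  have gt: "w ! g i' < w ! f i" if "i < P j" "P j \<le> i'" "i' < m" for i i'
  proof -
    have "w ! g i' \<le> w ! f i" using f(3)[OF that(1)] le[OF that(2,3)] by linarith
    moreover have "f i \<noteq> g i'" using f(2)[OF that(1)] g(2)[OF that(2,3)] by simp
    moreover have "g i' < length w" "f i < length w"
      using g(1) f(1) that by (auto simp: embeds_def)
    ultimately show ?thesis using w by (simp add: is_perm_iff nth_eq_iff_index_eq order_less_le)
  qed
  have "embeds q w {..<m} h"
    unfolding embeds_def
  proof (intro conjI ballI impI)
    fix i assume "i \<in> {..<m}"
    then show "h i < length w" using f(1) g(1) by (auto simp: h_def embeds_def)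
  next
    fix i i' assume i: "i \<in> {..<m}" "i' \<in> {..<m}"
    show "h i < h i'" if "i < i'"
      using f(1) g(1) f(2)[of i] g(2)[of i'] i that
      by (auto simp: h_def embeds_def intro: order_less_le_trans)
    show "w ! h i < w ! h i' \<longleftrightarrow> q ! i < q ! i'"
      using f(1) g(1) i gt[of i i'] gt[of i' i] cut[of j i i'] cut[of j i' i] j
      by (auto simp: h_def embeds_def not_less dest: order_less_asym)
  qed
  then have "map h [0..<m] \<in> copies q w" using embeds_imp_copy[of q w h] by (simp add: q_facts)
  then have "h ` {0..<m} \<subseteq> {..<x}" using left by fastforce
  then have "h (m - 1) < x" using m_pos by (simp add: image_subset_iff)
  then show False using g(2)[OF last] last by (simp add: h_def)
qed

lemma touching_embedding_eq:
  assumes f: "embeds q (insert_copy w x) {..<m} f"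
    and touch: "i0 < m" "x \<le> f i0" "f i0 < x + m"
    and i: "i < m"
  shows "f i = x + i"
proof -
  have f_mono: "f i < f j" if "i < j" "j < m" for i j
    using f that by (auto simp: embeds_def)
  have f_iff: "insert_copy w x ! f i < insert_copy w x ! f j \<longleftrightarrow> q ! i < q ! j"
    if "i < m" "j < m" for i j
    using f that by (auto simp: embeds_def)
  have f_lt: "f i < length w + m" if "i < m" for i
    using f that by (auto simp: embeds_def)
  \<comment> \<open>As \<open>f\<close> is increasing, the positions it sends below \<open>z\<close>
    form an initial segment. Applied to both ends of the window, this yields \<open>A\<close> and
    \<open>B\<close>: exactly the positions from \<open>A\<close> to \<open>B - 1\<close> are sent
    into the window.\<close>
  have threshold: "\<exists>A\<le>m. \<forall>i<m. f i < z \<longleftrightarrow> i < A" for z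
  proof -
    define A where "A = (LEAST a. a = m \<or> z \<le> f a)"
    have "A \<le> m" unfolding A_def by (rule Least_le) simp
    moreover have "A = m \<or> z \<le> f A" unfolding A_def by (rule LeastI[of _ m]) simp
    moreover have "f i < z" if "i < A" for i
      using not_less_Least[of i "\<lambda>a. a = m \<or> z \<le> f a"] that by (auto simp: A_def)
    moreover have "f A \<le> f i" if "A \<le> i" "i < m" for i
      using f_mono[of A i] that by (cases "A = i") auto
    ultimately show ?thesis by (metis leD leI order_less_le_trans)
  qed
  obtain A where A: "A \<le> m" "\<And>i. i < m \<Longrightarrow> f i < x \<longleftrightarrow> i < A" using threshold[of x] by blast
  obtain B where B: "B \<le> m" "\<And>i. i < m \<Longrightarrow> f i < x + m \<longleftrightarrow> i < B" using threshold[of "x + m"] by blast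
  have AB: "A < B" using A B touch by (meson leD leI order_le_less_trans)
  \<comment> \<open>\<open>u i\<close> is the value of \<open>q\<close> whose inserted entry plays
    the role of position \<open>i\<close> in the copy.\<close>
  define u where "u = (\<lambda>i. q ! (f i - x))"
  have inner: "x \<le> f i" "f i < x + m" if "A \<le> i" "i < B" for i
    using A(2)[of i] B(1) B(2)[of i] that by auto
  have u_range: "1 \<le> u i" "u i \<le> m" if "A \<le> i" "i < B" for i
    using q_nth[of "f i - x"] inner[OF that] by (auto simp: u_def)
  have nth_inner: "insert_copy w x ! f i = u i + Y (u i)" if "A \<le> i" "i < B" for i
    using nth_insert_copy_inner inner[OF that] by (simp add: u_def)
  \<comment> \<open>Comparing an inserted entry with an old one amounts to comparing the height with
    the old value in \<open>w\<close>.\<close>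
  have left_above: "Y (u i) < w ! f i'" if "A \<le> i" "i < B" "i' < A" "q ! i < q ! i'" for i i'
    using f_iff[of i i'] nth_inner[of i] nth_insert_copy_left[of "f i'"] A(1) A(2)[of i'] B(1) that
      lift_less_inner_iff(2)[of "f i - x" "w ! f i'"] inner[of i] by (auto simp: u_def)
  have left_below: "w ! f i' \<le> Y (u i)" if "A \<le> i" "i < B" "i' < A" "q ! i' < q ! i" for i i'
    using f_iff[of i' i] nth_inner[of i] nth_insert_copy_left[of "f i'"] A(1) A(2)[of i'] B(1) that
      lift_less_inner_iff(1)[of "f i - x" "w ! f i'"] inner[of i] by (auto simp: u_def)
  have right_nth: "insert_copy w x ! f i' = lift m Y (w ! (f i' - m))" if "B \<le> i'" "i' < m" for i'
    using nth_insert_copy_right[of "f i'"] B(2)[of i'] f_lt[of i'] that by auto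
  have right_above: "Y (u i) < w ! (f i' - m)" if "A \<le> i" "i < B" "B \<le> i'" "i' < m" "q ! i < q ! i'" for i i'
    using f_iff[of i i'] nth_inner[of i] right_nth[of i'] that
      lift_less_inner_iff(2)[of "f i - x" "w ! (f i' - m)"] inner[of i] by (auto simp: u_def)
  have right_below: "w ! (f i' - m) \<le> Y (u i)" if "A \<le> i" "i < B" "B \<le> i'" "i' < m" "q ! i' < q ! i" for i i'
    using f_iff[of i' i] nth_inner[of i] right_nth[of i'] that
      lift_less_inner_iff(1)[of "f i - x" "w ! (f i' - m)"] inner[of i] by (auto simp: u_def)
  have "A < m" "B - 1 < m" using AB B(1) by auto
  \<comment> \<open>\<open>c\<close> and \<open>d\<close> are the blocks of the first and last
    position sent into the window. With blocks counted from 0, the levels that remain are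
    \<open>c + 1, ..., d\<close>.\<close>
  obtain c where c: "c < k" "P c \<le> A" "A < P (Suc c)" by (rule exists_block[OF \<open>A < m\<close>])
  obtain d where d: "d < k" "P d \<le> B - 1" "B - 1 < P (Suc d)" by (rule exists_block[OF \<open>B - 1 < m\<close>])
  have d': "P d < B" "B \<le> P (Suc d)" using d AB by auto

  \<comment> \<open>Otherwise the first \<open>P (level (u i))\<close> entries of the copy all lie
    left of the window, and one of them has value at most \<open>Y (u i)\<close> in
    \<open>w\<close>. But it belongs to an earlier block than \<open>i\<close>, so it must lie above
    the inserted entry.\<close>
  have level_lower: "c < level (u i)" if i: "A \<le> i" "i < B" for i
  proof (rule ccontr)
    assume "\<not> c < level (u i)"
    define a where "a = P (level (u i))"
    have a: "0 < a" "a \<le> P c"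
      using P_pos[of "level (u i)"] P_mono[of "level (u i)" c] level_props[of "u i"] c(1)
        \<open>\<not> c < level (u i)\<close> by (auto simp: a_def)
    have lt: "f i' < x" if "i' < a" for i' using A(1) A(2)[of i'] that a c(2) by auto
    have "embeds q w {..<a} f"
      by (rule embeds_left[OF embeds_subset[OF f]]) (use lt a c A in auto)
    then obtain i' where i': "i' < a" "w ! f i' \<le> H a" using height_left[OF a(1)] lt by blast
    have "q ! i < q ! i'" using cut[of c i' i] c i' a i B by auto
    then show False using left_above[OF i, of i'] i' a c by (auto simp: a_def)
  qed
  \<comment> \<open>Mirror image: otherwise the blocks from index \<open>level (u i)\<close> on lie
    right of the window and below the inserted entry, which \<open>height_right\<close>
    forbids.\<close>
  have level_upper: "level (u i) \<le> d" if i: "A \<le> i" "i < B" for i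
  proof (rule ccontr)
    assume n: "\<not> level (u i) \<le> d"
    define j where "j = level (u i)"
    have j: "d < j" "j < k" using level_props[of "u i"] n k_ge_2 by (auto simp: j_def)
    have Pj: "B \<le> P j" using P_mono[of "Suc d" j] j d' by auto
    have ge: "x + m \<le> f i'" if "P j \<le> i'" "i' < m" for i' using B(2)[of i'] that Pj by auto
    have "embeds q w {P j..<m} (\<lambda>i. f i - m)"
      by (rule embeds_right[OF embeds_subset[OF f]]) (use ge in auto)
    then show False
    proof (rule height_right[OF j(2)])
      fix i' assume i': "P j \<le> i'" "i' < m"
      show "x \<le> f i' - m" using ge[OF i'] by simp
      have "q ! i' < q ! i" using cut[of "Suc d" i i'] d d' i i' Pj P_mono[of "Suc d" j] j by auto
      then show "w ! (f i' - m) \<le> H (P j)"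
        using right_below[OF i, of i'] i' Pj by (auto simp: j_def)
    qed
  qed
  have cd: "c < d" using level_lower[of A] level_upper[of A] AB by auto
  \<comment> \<open>An ascent of block \<open>c\<close> across \<open>A\<close> has its lower entry
    left of the window. The value of that entry separates the height of the upper entry from those
    of all later blocks, so the latter have a strictly larger level.\<close>
  have left_partial: "Suc c < level (u i)" if "P c < A" "P (Suc c) \<le> i" "i < B" for i
  proof -
    obtain i1 i2 where i12: "P c \<le> i1" "i1 < A" "A \<le> i2" "i2 < P (Suc c)" "q ! i1 < q ! i2"
      using block_ascent[OF c(1) \<open>P c < A\<close> c(3)] by blast
    have "i2 < B" using i12 that by simp
    then have 1: "w ! f i1 \<le> Y (u i2)" using left_below[of i2 i1] i12 by simp
    have "q ! i < q ! i1" using cut[of "Suc c" i1 i] c i12 that B(1) by auto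
    then have "Y (u i) < w ! f i1" using left_above[of i i1] i12 that c by simp
    then have "level (u i2) < level (u i)" using 1 by (intro Y_less_imp_level) simp
    then show ?thesis using level_lower[of i2] i12 \<open>i2 < B\<close> by simp
  qed
  \<comment> \<open>The same with an ascent of block \<open>d\<close> across \<open>B\<close>, whose
    upper entry lies right of the window.\<close>
  have right_partial: "level (u i) < d" if "B < P (Suc d)" "A \<le> i" "i < P d" for i
  proof -
    obtain i1 i2 where i12: "P d \<le> i1" "i1 < B" "B \<le> i2" "i2 < P (Suc d)" "q ! i1 < q ! i2"
      using block_ascent[OF d(1) d'(1) \<open>B < P (Suc d)\<close>] by blast
    have i2m: "i2 < m" using i12 P_mono[of "Suc d" k] d P_k by simp
    have "A \<le> i1" using i12 that by simp
    then have 1: "Y (u i1) < w ! (f i2 - m)" using right_above[of i1 i2] i12 i2m by simp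
    have "q ! i2 < q ! i" using cut[of d i i2] d i12 that i2m by auto
    then have "w ! (f i2 - m) \<le> Y (u i)" using right_below[of i i2] i12 that d' i2m by simp
    then have "level (u i) < level (u i1)" using 1 by (intro Y_less_imp_level) simp
    then show ?thesis using level_upper[of i1] i12 \<open>A \<le> i1\<close> by simp
  qed

  \<comment> \<open>Distinct positions use distinct inserted entries, so they cannot outnumber the
    ranks from the top available to them.\<close>
  have count: "b - a \<le> hi - lo"
    if ab: "A \<le> a" "b \<le> B" and rank: "\<And>i. a \<le> i \<Longrightarrow> i < b \<Longrightarrow> lo \<le> m - u i \<and> m - u i < hi" for a b lo hi
  proof -
    have "inj_on (\<lambda>i. m - u i) {a..<b}"
    proof (rule inj_onI)
      fix i j assume ij: "i \<in> {a..<b}" "j \<in> {a..<b}" "m - u i = m - u j"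
      then have "u i = u j" using u_range[of i] u_range[of j] ab by auto
      then have "f i - x = f j - x"
        using inner[of i] inner[of j] ij ab q_facts by (auto simp: u_def nth_eq_iff_index_eq)
      then have "f i = f j" using inner[of i] inner[of j] ij ab by auto
      then show "i = j" using f_mono[of i j] f_mono[of j i] ij ab B(1) by (cases i j rule: linorder_cases) auto
    qed
    moreover have "(\<lambda>i. m - u i) ` {a..<b} \<subseteq> {lo..<hi}" using rank by auto
    ultimately show ?thesis using card_inj_on_le[of _ "{a..<b}" "{lo..<hi}"] by fastforce
  qed
  have rank_lt_m: "m - u i < m" if "A \<le> i" "i < B" for i using u_range[OF that] m_pos by simp
  have P_cd: "P (Suc c) \<le> P d" using P_mono[of "Suc c" d] cd d by simp

  have AB1: "A \<le> B - 1" "B - 1 < B" using AB by auto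
  \<comment> \<open>The cases distinguish whether the first and the last block are met partially.
    Each time the full blocks are too large for the ranks left, except when all blocks are met in
    full.\<close>
  have "A = 0 \<and> B = m"
  proof (cases "P c < A"; cases "B < P (Suc d)")
    assume cA: "P c < A" and dB: "B < P (Suc d)"
    \<comment> \<open>If the two blocks were adjacent, position \<open>B - 1\<close> would need a
      level above \<open>Suc c\<close> and at most \<open>d\<close>.\<close>
    have "d \<noteq> Suc c"
      using left_partial[OF cA, of "B - 1"] level_upper[OF AB1] d(2) AB1 by auto
    then have e: "P (Suc c) \<le> P (d - 1)" "P (d - 1) < P d" "d - 1 < k - 1"
      using cd d P_mono[of "Suc c" "d - 1"] P_strict_mono[of "d - 1" d] by auto
    have "P d - P (Suc c) \<le> Suc (P (d - 1)) - Suc (P (Suc c))"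
    proof (rule count)
      fix i assume i: "P (Suc c) \<le> i" "i < P d"
      have "Suc c < level (u i)" using left_partial[OF cA] i d' by simp
      moreover have "level (u i) \<le> d - 1" using right_partial[OF dB, of i] i c by simp
      ultimately show "Suc (P (Suc c)) \<le> m - u i \<and> m - u i < Suc (P (d - 1))"
        using level_gt_imp[of "Suc c" "u i"] level_le_imp[of "u i" "d - 1"] e(3) by simp
    qed (use c d' in auto)
    then show ?thesis using e by linarith
  next
    assume cA: "P c < A" and "\<not> B < P (Suc d)"
    then have Bd: "B = P (Suc d)" using d' by simp
    have lower: "P (Suc c) < m - u i" if "P (Suc c) \<le> i" "i < P (Suc d)" for i
      using level_gt_imp[of "Suc c" "u i"] left_partial[OF cA, of i] that Bd by simp
    show ?thesis
    proof (cases "d = k - 1")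
      case True
      have "P (Suc d) - P (Suc c) \<le> m - Suc (P (Suc c))"
      proof (rule count)
        fix i assume i: "P (Suc c) \<le> i" "i < P (Suc d)"
        show "Suc (P (Suc c)) \<le> m - u i \<and> m - u i < m"
          using lower[OF i] rank_lt_m[of i] i c Bd by simp
      qed (use c Bd in auto)
      moreover have "P (Suc d) = m" "P (Suc c) < m"
        using True P_k k_ge_2 P_less_m[of "Suc c"] cd d by auto
      ultimately show ?thesis by linarith
    next
      case False
      then have dk: "d < k - 1" using d by simp
      have "P (Suc d) - P (Suc c) \<le> Suc (P d) - Suc (P (Suc c))"
      proof (rule count)
        fix i assume i: "P (Suc c) \<le> i" "i < P (Suc d)"
        have "level (u i) \<le> d" using level_upper[of i] i c Bd by simp
        then show "Suc (P (Suc c)) \<le> m - u i \<and> m - u i < Suc (P d)"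
          using lower[OF i] level_le_imp[of "u i" d] dk by simp
      qed (use c Bd in auto)
      then show ?thesis using P_cd P_strict_mono[of d "Suc d"] d by linarith
    qed
  next
    assume "\<not> P c < A" and dB: "B < P (Suc d)"
    then have Ac: "A = P c" using c by simp
    have Pcd: "P c < P d" using P_strict_mono[of c d] cd d by simp
    have d1: "1 \<le> d - 1"
      using right_partial[OF dB, of A] level_props(1)[of "u A"] Ac Pcd by auto
    have dk: "d - 1 < k - 1" using d d1 by simp
    \<comment> \<open>The ranks up to \<open>P (d - 1)\<close> include one entry beyond the blocks
      before \<open>d - 1\<close>, \<open>d - 1\<close> being their total length cut; block
      \<open>d - 1\<close> is a middle block, and its second entry tips the count.\<close>
    have e: "P c \<le> P (d - 1)" "P (d - 1) + 2 \<le> P d"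
      using P_mono[of c "d - 1"] middle_size[of "d - 1"] cd d d1 by auto
    have "P d - P c \<le> Suc (P (d - 1)) - P c"
    proof (rule count)
      fix i assume i: "P c \<le> i" "i < P d"
      have "c < level (u i)" using level_lower[of i] i Ac d' by simp
      moreover have "level (u i) \<le> d - 1" using right_partial[OF dB, of i] i Ac by simp
      ultimately show "P c \<le> m - u i \<and> m - u i < Suc (P (d - 1))"
        using level_gt_imp_weak[of c "u i"] level_le_imp[of "u i" "d - 1"] dk by simp
    qed (use Ac d' in auto)
    then show ?thesis using e by linarith
  next
    assume "\<not> P c < A" and "\<not> B < P (Suc d)"
    then have Ac: "A = P c" and Bd: "B = P (Suc d)" using c d' by auto
    show ?thesis
    proof (cases "d = k - 1")
      case True
      then have Bm: "B = m" using Bd P_k k_ge_2 by simp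
      have "c = 0"
      proof (rule ccontr)
        \<comment> \<open>Rank \<open>P c\<close> was given to level \<open>c\<close>, which is
          excluded, so one rank is missing.\<close>
        assume "c \<noteq> 0"
        have "m - P c \<le> m - Suc (P c)"
        proof (rule count)
          fix i assume "P c \<le> i" "i < m"
          then show "Suc (P c) \<le> m - u i \<and> m - u i < m"
            using level_gt_imp[of c "u i"] level_lower[of i] rank_lt_m[of i] Ac Bm \<open>c \<noteq> 0\<close> by simp
        qed (use Ac Bm in auto)
        then show False using P_less_m[OF c(1)] by linarith
      qed
      then show ?thesis using Ac Bm P_0 by simp
    next
      case False
      then have dk: "d < k - 1" using d by simp
      have "P (Suc d) - P c \<le> Suc (P d) - P c"
      proof (rule count)
        fix i assume "P c \<le> i" "i < P (Suc d)"
        then show "P c \<le> m - u i \<and> m - u i < Suc (P d)"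
          using level_gt_imp_weak[of c "u i"] level_lower[of i] level_le_imp[of "u i" d]
            level_upper[of i] Ac Bd dk by simp
      qed (use Ac Bd in auto)
      moreover have "P d + 2 \<le> P (Suc d)" using middle_size[of d] cd dk by simp
      ultimately show ?thesis using P_mono[of c d] cd d by linarith
    qed
  qed
  \<comment> \<open>Now \<open>f\<close> maps \<open>m\<close> positions increasingly into a window
    of length \<open>m\<close>; induction from either end pins it down.\<close>
  then have all: "x \<le> f i" "f i < x + m" if "i < m" for i using inner that by auto
  have lower: "x + i \<le> f i" if "i < m" for i
    using that
  proof (induction i)
    case (Suc i)
    then show ?case using f_mono[of i "Suc i"] by simp
  qed (use all in simp)
  have upper: "f (m - 1 - i) \<le> x + (m - 1 - i)" if "i < m" for i
    using that
  proof (induction i)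
    case 0 then show ?case using all(2)[of "m - 1"] by simp
  next
    case (Suc i)
    then have "f (m - 1 - Suc i) < f (m - 1 - i)" by (intro f_mono) auto
    then show ?case using Suc by simp
  qed
  show ?thesis using lower[OF i] upper[of "m - 1 - i"] i by simp
qed

lemma copies_insert_copy: "copies q (insert_copy w x) = insert [x..<x + m] (copies q w)"
proof (intro equalityI subsetI)
  fix ns assume ns: "ns \<in> copies q (insert_copy w x)"
  then have len: "length ns = m" and emb: "embeds q (insert_copy w x) {..<m} ((!) ns)"
    by (auto simp: copies_iff_embeds q_facts)
  show "ns \<in> insert [x..<x + m] (copies q w)"
  proof (cases "\<exists>i<m. x \<le> ns ! i \<and> ns ! i < x + m")
    case True
    then obtain i0 where i0: "i0 < m" "x \<le> ns ! i0" "ns ! i0 < x + m" by blast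
    have "ns = [x..<x + m]"
      by (rule nth_equalityI) (simp_all add: len touching_embedding_eq[OF emb i0])
    then show ?thesis by simp
  next
    case False
    \<comment> \<open>Closing the window turns a copy that avoids it into a copy in
      \<open>w\<close>. That copy lies left of \<open>x\<close>, so no index was shifted at
      all.\<close>
    let ?g = "\<lambda>i. if ns ! i < x then ns ! i else ns ! i - m"
    have out: "ns ! i < x \<or> x + m \<le> ns ! i" if "i < m" for i using False that by force
    have "embeds q w {..<m} ?g" by (rule embeds_outside[OF emb]) (use out in auto)
    then have "map ?g [0..<m] \<in> copies q w" using embeds_imp_copy[of q w ?g] by (simp add: q_facts)
    then have sub: "set (map ?g [0..<m]) \<subseteq> {..<x}" by (rule left)
    have "ns ! i < x" if "i < m" for i
    proof -
      have "?g i \<in> set (map ?g [0..<m])" using that by simp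
      then have "?g i < x" using sub by blast
      then show ?thesis using out[OF that] by (cases "ns ! i < x") auto
    qed
    then have "embeds q w {..<m} ((!) ns)" by (intro embeds_left[OF emb]) auto
    then show ?thesis using len by (simp add: copies_iff_embeds q_facts)
  qed
next
  fix ns assume "ns \<in> insert [x..<x + m] (copies q w)"
  then show "ns \<in> copies q (insert_copy w x)"
  proof
    assume ns: "ns = [x..<x + m]"
    have nth: "insert_copy w x ! (ns ! i) = q ! i + Y (q ! i)" if "i < m" for i
      using that by (simp add: ns nth_insert_copy_inner)
    have "embeds q (insert_copy w x) {..<m} ((!) ns)"
      unfolding embeds_def
    proof (intro conjI ballI impI)
      fix i j assume "i \<in> {..<m}" "j \<in> {..<m}"
      then show "insert_copy w x ! (ns ! i) < insert_copy w x ! (ns ! j) \<longleftrightarrow> q ! i < q ! j"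
        using nth inner_less_iff by simp
    qed (use x in \<open>simp_all add: ns\<close>)
    then show ?thesis by (simp add: copies_iff_embeds q_facts ns)
  next
    assume ns: "ns \<in> copies q w"
    then have len: "length ns = m" and emb: "embeds q w {..<m} ((!) ns)"
      by (simp_all add: copies_iff_embeds q_facts)
    have "insert_copy w x ! (ns ! i) = lift m Y (w ! (ns ! i))" if "i < m" for i
      by (rule nth_insert_copy_left) (use left[OF ns] nth_mem[of i ns] len that in blast)
    then have "embeds q (insert_copy w x) {..<m} ((!) ns)"
      using emb by (simp add: embeds_def lift_less_iff trans_less_add1)
    then show ?thesis using len by (simp add: copies_iff_embeds q_facts)
  qed
qed

lemma new_copy_notin: "[x..<x + m] \<notin> copies q w"
proof
  assume "[x..<x + m] \<in> copies q w"
  from left[OF this] have "{x..<x + m} \<subseteq> {..<x}" by simp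
  moreover have "x \<in> {x..<x + m}" using m_pos by simp
  ultimately have "x \<in> {..<x}" by blast
  then show False by simp
qed

end

end

text \<open>Both sides have the same copies. If the gaps differed, each new copy would be an old
  copy on the other side and so lie left of the other gap, giving \<open>x < x'\<close> and
  \<open>x' < x\<close>.\<close>

lemma insert_copy_inject:
  assumes eq: "insert_copy w x = insert_copy w' x'"
    and w: "is_perm w" "x \<le> length w" "\<And>ns. ns \<in> copies q w \<Longrightarrow> set ns \<subseteq> {..<x}"
    and w': "is_perm w'" "x' \<le> length w'" "\<And>ns. ns \<in> copies q w' \<Longrightarrow> set ns \<subseteq> {..<x'}"
  shows "w = w' \<and> x = x'"
proof -
  have eq': "insert [x..<x + m] (copies q w) = insert [x'..<x' + m] (copies q w')"
    using copies_insert_copy[OF w] copies_insert_copy[OF w'] eq by simp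
  have inj: "a = b" if "[a..<a + m] = [b..<b + m]" for a b
    using arg_cong[OF that, of hd] m_pos by simp
  have sub: "a < b" if "set [a..<a + m] \<subseteq> {..<b}" for a b
  proof -
    have "a \<in> set [a..<a + m]" using m_pos by simp
    then show ?thesis using that by blast
  qed
  have "[x..<x + m] = [x'..<x' + m] \<or> [x..<x + m] \<in> copies q w'"
    "[x'..<x' + m] = [x..<x + m] \<or> [x'..<x' + m] \<in> copies q w" using eq' by blast+
  then have "x = x' \<or> x < x'" "x' = x \<or> x' < x"
    using inj[of x x'] inj[of x' x] sub[OF w(3), of x'] sub[OF w'(3), of x] by blast+
  then have x: "x = x'" by linarith
  then show ?thesis
    using insert_pattern_inject[OF _ w(1) w'(1) w(2)] eq by (simp add: insert_copy_def)
qed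

section \<open>Repeated insertion from left to right\<close>

fun insert_copies :: "nat list \<Rightarrow> (nat \<Rightarrow> nat) \<Rightarrow> nat \<Rightarrow> nat list" where
  "insert_copies p g 0 = p"
| "insert_copies p g (Suc i) = insert_copy (insert_copies p g i) (g i + i * m)"

definition gaps :: "nat \<Rightarrow> nat \<Rightarrow> (nat \<Rightarrow> nat) \<Rightarrow> bool" where
  "gaps N r g \<longleftrightarrow> (\<forall>i<r. g i \<le> N) \<and> (\<forall>i j. i < j \<longrightarrow> j < r \<longrightarrow> g i < g j)"

lemma insert_copies_props:
  assumes p: "is_perm p" "copies q p = {}" and g: "gaps (length p) r g" and "i \<le> r"
  shows "is_perm (insert_copies p g i) \<and> length (insert_copies p g i) = length p + i * m \<and>
    card (copies q (insert_copies p g i)) = i \<and>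
    (\<forall>ns\<in>copies q (insert_copies p g i). i < r \<longrightarrow> set ns \<subseteq> {..<g i + i * m})"
  using \<open>i \<le> r\<close>
proof (induction i)
  case 0
  then show ?case using p by simp
next
  case (Suc i)
  \<comment> \<open>Gaps refer to the original permutation; the \<open>i\<close> earlier insertions
    lie to the left and shift this one by \<open>i * m\<close>.\<close>
  let ?w = "insert_copies p g i" and ?x = "g i + i * m"
  have IH: "is_perm ?w" "length ?w = length p + i * m" "card (copies q ?w) = i"
    "\<And>ns. ns \<in> copies q ?w \<Longrightarrow> set ns \<subseteq> {..<?x}"
    using Suc by auto
  have x: "?x \<le> length ?w" using g Suc.prems IH(2) by (simp add: gaps_def)
  have "set ns \<subseteq> {..<g (Suc i) + Suc i * m}"
    if "ns \<in> copies q (insert_copy ?w ?x)" "Suc i < r" for ns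
  proof -
    have lt: "g i < g (Suc i)" using g that(2) by (simp add: gaps_def)
    have "ns = [?x..<?x + m] \<or> ns \<in> copies q ?w"
      using that(1) copies_insert_copy[OF IH(1) x IH(4)] by blast
    then have "set ns \<subseteq> {..<?x + m}" using IH(4)[of ns] by fastforce
    then show ?thesis using lt by fastforce
  qed
  then show ?case
    using is_perm_insert_copy[OF IH(1) x] IH(2,3) new_copy_notin[OF IH(1) x IH(4)]
    by (simp add: copies_insert_copy[OF IH(1) x IH(4)] finite_copies)
qed

lemma insert_copies_inject:
  assumes p: "is_perm p" "copies q p = {}" "gaps (length p) r g"
    and p': "is_perm p'" "copies q p' = {}" "gaps (length p') r g'"
    and "i \<le> r" "insert_copies p g i = insert_copies p' g' i"
  shows "p = p' \<and> (\<forall>j<i. g j = g' j)"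
  using assms(7,8)
proof (induction i)
  case (Suc i)
  then have i: "i < r" "i \<le> r" by auto
  note props = insert_copies_props[OF p i(2)] insert_copies_props[OF p' i(2)]
  have "insert_copies p g i = insert_copies p' g' i \<and> g i + i * m = g' i + i * m"
  proof (rule insert_copy_inject)
    show "insert_copy (insert_copies p g i) (g i + i * m) =
        insert_copy (insert_copies p' g' i) (g' i + i * m)"
      using Suc.prems by simp
  qed (use props i p(3) p'(3) in \<open>auto simp: gaps_def\<close>)
  then show ?case using Suc.IH i by (auto simp: less_Suc_eq)
qed simp

section \<open>Padding and assembly of the injection\<close>

lemma is_perm_snoc_max:
  assumes "is_perm p"
  shows "is_perm (p @ [Suc (length p)])"
  using assms by (intro is_permI) (auto simp: is_perm_iff)

text \<open>Since \<open>q\<close> has at least two skew blocks, its last entry is smaller than its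
  first. So a final maximum cannot end a copy, and any copy would already lie in
  \<open>p\<close>.\<close>

lemma copies_snoc_max:
  assumes "is_perm p" "copies q p = {}"
  shows "copies q (p @ [Suc (length p)]) = {}"
proof (rule ccontr)
  assume "copies q (p @ [Suc (length p)]) \<noteq> {}"
  then obtain ns where ns: "ns \<in> copies q (p @ [Suc (length p)])" by blast
  then have len: "length ns = m" and emb: "embeds q (p @ [Suc (length p)]) {..<m} ((!) ns)"
    by (auto simp: copies_iff_embeds q_facts)
  have m1: "1 < m" using P_pos[of 1] P_less_m[of 1] k_ge_2 by simp
  then have "q ! (m - 1) < q ! 0"
    using cut[of 1 0 "m - 1"] P_pos[of 1] P_less_m[of 1] k_ge_2 by simp
  then have desc: "(p @ [Suc (length p)]) ! (ns ! (m - 1)) < (p @ [Suc (length p)]) ! (ns ! 0)"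
    using emb m1 by (simp add: embeds_def)
  have "ns ! 0 < ns ! (m - 1)" "ns ! (m - 1) < Suc (length p)"
    using emb m1 by (auto simp: embeds_def)
  then have last: "ns ! (m - 1) < length p"
    using desc is_perm_nth(2)[OF assms(1), of "ns ! 0"]
    by (cases "ns ! (m - 1) = length p") (auto simp: nth_append)
  have lt: "ns ! i < length p" if "i < m" for i
  proof (cases "i = m - 1")
    case False
    then have "ns ! i < ns ! (m - 1)" using emb that by (simp add: embeds_def)
    then show ?thesis using last by simp
  qed (use last in simp)
  have "embeds q p {..<m} ((!) ns)" using emb lt by (simp add: embeds_def nth_append)
  then have "ns \<in> copies q p" using len by (simp add: copies_iff_embeds q_facts)
  then show False using assms(2) by simp
qed

lemma pad_avoider:
  assumes "is_perm p" "copies q p = {}"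
  shows "is_perm (p @ [Suc (length p)..<Suc (length p + l)]) \<and>
    copies q (p @ [Suc (length p)..<Suc (length p + l)]) = {}"
proof (induction l)
  case 0
  then show ?case using assms by simp
next
  case (Suc l)
  let ?p = "p @ [Suc (length p)..<Suc (length p + l)]"
  have eq: "p @ [Suc (length p)..<Suc (length p + Suc l)] = ?p @ [Suc (length ?p)]" by simp
  have "is_perm (?p @ [Suc (length ?p)])"
    using Suc by (intro is_perm_snoc_max) simp
  then show ?case using copies_snoc_max[of ?p] Suc unfolding eq by blast
qed

lemma ksubset_injection:
  fixes N r l :: nat
  shows "\<exists>\<phi> :: int set \<times> nat list \<Rightarrow> nat list.
    inj_on \<phi> (ksubsets (int N + 1) r \<times> avoiders (int N) q) \<and>
    \<phi> ` (ksubsets (int N + 1) r \<times> avoiders (int N) q)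
      \<subseteq> perms_with_copies (int (N + l + r * m)) r q"
proof -
  define pad where "pad = (\<lambda>p :: nat list. p @ [Suc (length p)..<Suc (length p + l)])"
  \<comment> \<open>Subtracting 1 turns the elements of \<open>{1..N + 1}\<close> into the gaps
    \<open>0, ..., N\<close>, those not beyond the original avoider.\<close>
  define g where "g = (\<lambda>A i. nat (sorted_list_of_set A ! i) - 1)"
  define \<phi> where "\<phi> = (\<lambda>(A :: int set, p). insert_copies (pad p) (g A) r)"
  have pad: "is_perm (pad p)" "copies q (pad p) = {}" "length (pad p) = N + l"
    if "p \<in> avoiders (int N) q" for p
    using that pad_avoider[of p l] by (auto simp: avoiders_def pad_def)
  have A: "finite A" "length (sorted_list_of_set A) = r" "set (sorted_list_of_set A) = A"
    "\<And>i. i < r \<Longrightarrow> 1 \<le> sorted_list_of_set A ! i \<and> sorted_list_of_set A ! i \<le> int N + 1"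
    if "A \<in> ksubsets (int N + 1) r" for A
  proof -
    show fin: "finite A" using that by (auto simp: ksubsets_def intro: finite_subset)
    show len: "length (sorted_list_of_set A) = r" using that by (simp add: ksubsets_def)
    show set: "set (sorted_list_of_set A) = A" using fin by simp
    fix i assume "i < r"
    then have "sorted_list_of_set A ! i \<in> A" using len set nth_mem by metis
    then show "1 \<le> sorted_list_of_set A ! i \<and> sorted_list_of_set A ! i \<le> int N + 1"
      using that by (auto simp: ksubsets_def)
  qed
  have gaps: "gaps (N + l) r (g A)" if "A \<in> ksubsets (int N + 1) r" for A
    unfolding gaps_def
  proof (intro conjI allI impI)
    fix i assume "i < r"
    then show "g A i \<le> N + l" using A(4)[OF that, of i] unfolding g_def by linarith
  next
    fix i j assume "i < j" "j < r"
    then have "sorted_list_of_set A ! i < sorted_list_of_set A ! j"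
      using strict_sorted_list_of_set[of A] A(2)[OF that] by (simp add: sorted_wrt_iff_nth_less)
    then show "g A i < g A j"
      using A(4)[OF that, of i] A(4)[OF that, of j] \<open>i < j\<close> \<open>j < r\<close> by (simp add: g_def)
  qed
  have "inj_on \<phi> (ksubsets (int N + 1) r \<times> avoiders (int N) q)"
  proof (rule inj_onI, clarify)
    fix A p A' p'
    assume mem: "A \<in> ksubsets (int N + 1) r" "p \<in> avoiders (int N) q"
      "A' \<in> ksubsets (int N + 1) r" "p' \<in> avoiders (int N) q" and eq: "\<phi> (A, p) = \<phi> (A', p')"
    have "pad p = pad p' \<and> (\<forall>j<r. g A j = g A' j)"
      by (rule insert_copies_inject[where i = r and r = r])
        (use pad[OF mem(2)] pad[OF mem(4)] gaps[OF mem(1)] gaps[OF mem(3)] eq in \<open>auto simp: \<phi>_def\<close>)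
    then have 1: "pad p = pad p'" and 2: "\<And>j. j < r \<Longrightarrow> g A j = g A' j" by auto
    have "length p = length p'" using mem by (auto simp: avoiders_def)
    then have "p = p'" using 1 by (simp add: pad_def)
    moreover have "sorted_list_of_set A = sorted_list_of_set A'"
    proof (rule nth_equalityI)
      fix i assume "i < length (sorted_list_of_set A)"
      then have i: "i < r" using A(2)[OF mem(1)] by simp
      show "sorted_list_of_set A ! i = sorted_list_of_set A' ! i"
        using 2[OF i] A(4)[OF mem(1) i] A(4)[OF mem(3) i] unfolding g_def by linarith
    qed (use A(2)[OF mem(1)] A(2)[OF mem(3)] in simp)
    ultimately show "A = A' \<and> p = p'" using A(3)[OF mem(1)] A(3)[OF mem(3)] by metis
  qed
  moreover have "\<phi> (A, p) \<in> perms_with_copies (int (N + l + r * m)) r q"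
    if "A \<in> ksubsets (int N + 1) r" "p \<in> avoiders (int N) q" for A p
    using insert_copies_props[OF pad(1,2)[OF that(2)], of r "g A" r] gaps[OF that(1)] pad(3)[OF that(2)]
    by (simp add: \<phi>_def perms_with_copies_def)
  ultimately show ?thesis by (intro exI[of _ \<phi>]) auto
qed

end


section \<open>Skew sums as cut patterns\<close>

lemma is_perm_Nil: "is_perm []"
  by (simp add: is_perm_iff)

lemma is_perm_skew_sum:
  assumes "is_perm a" "is_perm b"
  shows "is_perm (skew_sum a b)"
proof (rule is_permI)
  have ab: "distinct a" "set a = {1..length a}" "distinct b" "set b = {1..length b}"
    using assms by (auto simp: is_perm_iff)
  show "distinct (skew_sum a b)" using ab by (auto simp: skew_sum_def distinct_map)
  show "set (skew_sum a b) \<subseteq> {1..length (skew_sum a b)}"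
    unfolding skew_sum_def set_append set_map ab by auto
qed

lemma skew_sum_assoc: "skew_sum (skew_sum a b) c = skew_sum a (skew_sum b c)"
  by (simp add: skew_sum_def add.assoc add.commute)

lemma skew_sum_list_Nil: "skew_sum_list [] = []"
  and skew_sum_list_Cons: "skew_sum_list (a # qs) = skew_sum a (skew_sum_list qs)"
  by (simp_all add: skew_sum_list_def)

lemma skew_sum_list_append:
  "skew_sum_list (xs @ ys) = skew_sum (skew_sum_list xs) (skew_sum_list ys)"
proof (induction xs)
  case Nil
  then show ?case by (simp add: skew_sum_list_Nil skew_sum_def)
next
  case (Cons a xs)
  then show ?case by (simp add: skew_sum_list_Cons skew_sum_assoc)
qed

lemma length_skew_sum_list: "length (skew_sum_list qs) = sum_list (map length qs)"
  by (induction qs) (simp_all add: skew_sum_list_Nil skew_sum_list_Cons skew_sum_def)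

lemma is_perm_skew_sum_list:
  "(\<And>a. a \<in> set qs \<Longrightarrow> is_perm a) \<Longrightarrow> is_perm (skew_sum_list qs)"
  by (induction qs) (auto simp: skew_sum_list_Nil skew_sum_list_Cons is_perm_Nil intro: is_perm_skew_sum)

lemma skew_sum_nth_less:
  assumes "is_perm a" "is_perm b" "i < length a" "length a \<le> i'" "i' < length a + length b"
  shows "skew_sum a b ! i' < skew_sum a b ! i"
proof -
  have "1 \<le> a ! i" "b ! (i' - length a) \<le> length b"
    using assms by (auto intro!: is_perm_nth[simplified])
  then show ?thesis using assms by (simp add: skew_sum_def nth_append)
qed

text \<open>Without an ascent across \<open>s\<close>, every value after the split is below every
  value before it. The final values then form an initial interval, and splitting there writes
  \<open>b\<close> as a skew sum.\<close>

lemma skew_indecomposable_ascent: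
  assumes b: "is_perm b" "skew_indecomposable b" and s: "0 < s" "s < length b"
  shows "\<exists>i i'. i < s \<and> s \<le> i' \<and> i' < length b \<and> b ! i < b ! i'"
proof (rule ccontr)
  assume none: "\<not> ?thesis"
  define n where "n = length b"
  have bb: "distinct b" "set b = {1..n}" using b(1) by (auto simp: is_perm_iff n_def)
  have gt: "b ! i' < b ! i" if "i < s" "s \<le> i'" "i' < n" for i i'
  proof -
    have "b ! i' \<le> b ! i" using none that unfolding n_def by (meson not_less)
    moreover have "b ! i \<noteq> b ! i'" using bb(1) that by (simp add: nth_eq_iff_index_eq n_def)
    ultimately show ?thesis by simp
  qed
  let ?A = "set (take s b)" and ?B = "set (drop s b)"
  have less: "y < z" if yz: "y \<in> ?B" "z \<in> ?A" for y z
  proof -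
    obtain i where "i < s" "z = b ! i" using yz(2) by (auto simp: in_set_conv_nth)
    moreover obtain j where "j < n - s" "y = b ! (s + j)" using yz(1) by (auto simp: in_set_conv_nth n_def)
    ultimately show ?thesis using gt[of i "s + j"] by simp
  qed
  have un: "?A \<union> ?B = {1..n}" using bb(2) by (metis append_take_drop_id set_append)
  have cB: "card ?B = n - s" using bb(1) by (simp add: distinct_card n_def)
  have neB: "?B \<noteq> {}" using s by simp
  \<comment> \<open>A value up to the maximum of the suffix cannot occur in the prefix, whose values
    all exceed that maximum.\<close>
  have "{1..Max ?B} \<subseteq> ?B"
  proof
    fix v assume v: "v \<in> {1..Max ?B}"
    have max: "Max ?B \<in> ?B" using neB by simp
    then have "Max ?B \<le> n" using un by auto
    then have "v \<in> ?A \<union> ?B" using un v by auto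
    moreover have "v \<notin> ?A" using less[OF max, of v] v by auto
    ultimately show "v \<in> ?B" by simp
  qed
  moreover have "?B \<subseteq> {1..Max ?B}" using un by auto
  ultimately have B: "?B = {1..n - s}" using cB
    by (metis antisym card_atLeastAtMost diff_Suc_1)
  have A_gt: "n - s < z" "z \<le> n" if "z \<in> ?A" for z
  proof -
    show "n - s < z" using less[of "n - s" z] that s by (auto simp: B n_def)
    show "z \<le> n" using un that by auto
  qed
  define a where "a = map (\<lambda>v. v - (n - s)) (take s b)"
  have la: "length a = s" using s by (simp add: a_def)
  have "inj_on (\<lambda>v. v - (n - s)) ?A" by (rule inj_onI) (use A_gt in fastforce)
  then have "distinct a" using bb(1) by (simp add: a_def distinct_map)
  moreover have "set a \<subseteq> {1..length a}"
  proof
    fix v assume "v \<in> set a"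
    then obtain z where "z \<in> ?A" "v = z - (n - s)" by (auto simp: a_def)
    then show "v \<in> {1..length a}" using A_gt[of z] la s by (auto simp: n_def)
  qed
  ultimately have "is_perm a" by (rule is_permI)
  moreover have "is_perm (drop s b)" using bb(1) B by (simp add: is_perm_iff n_def)
  moreover have "b = skew_sum a (drop s b)"
  proof -
    have "map (\<lambda>v. v + length (drop s b)) a = map id (take s b)"
      unfolding a_def map_map by (rule map_cong) (use A_gt(1) in \<open>force simp: n_def\<close>)+
    then show ?thesis by (simp add: skew_sum_def)
  qed
  moreover have "a \<noteq> []" "drop s b \<noteq> []" using la s by auto
  ultimately show False using b(2) unfolding skew_indecomposable_def by blast
qed

lemma skew_blocks_skew_sum_list:
  assumes q: "q \<in> perms m" "q = skew_sum_list qs" and k: "k \<ge> 2" "length qs = k"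
    and blocks: "\<And>i. i < k \<Longrightarrow> is_perm (qs ! i) \<and> qs ! i \<noteq> [] \<and> skew_indecomposable (qs ! i)"
    and middle: "\<And>i. 1 \<le> i \<Longrightarrow> i < k - 1 \<Longrightarrow> qs ! i \<noteq> [1]"
  shows "skew_blocks q m k (\<lambda>j. sum_list (map length (take j qs)))"
proof -
  define P where "P = (\<lambda>j. sum_list (map length (take j qs)))"
  have len: "length q = m" using q(1) by (simp add: perms_iff)
  have P_Suc: "P (Suc j) = P j + length (qs ! j)" if "j < k" for j
    using that k by (simp add: P_def take_Suc_conv_app_nth)
  have Pk: "P k = m" using k(2) len q(2) by (simp add: P_def length_skew_sum_list)
  have perm: "is_perm (skew_sum_list (take j qs))" "is_perm (skew_sum_list (drop j qs))" for j
    using blocks k(2) by (intro is_perm_skew_sum_list; metis in_set_conv_nth in_set_takeD in_set_dropD)+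
  have split: "q = skew_sum (skew_sum_list (take j qs)) (skew_sum_list (drop j qs))" for j
    unfolding q(2) by (metis append_take_drop_id skew_sum_list_append)
  have lens: "length (skew_sum_list (take j qs)) = P j" "P j + length (skew_sum_list (drop j qs)) = m" for j
    using arg_cong[OF split[of j], of length] len
    by (simp_all add: P_def length_skew_sum_list skew_sum_def)
  \<comment> \<open>Within a block all entries are raised by the same amount, the total length of
    the later blocks, so ascents carry over to \<open>q\<close>.\<close>
  have block_nth: "q ! (P j + i) = qs ! j ! i + length (skew_sum_list (drop (Suc j) qs))"
    if "j < k" "i < length (qs ! j)" for i j
  proof -
    have "drop j qs = qs ! j # drop (Suc j) qs" using that k by (simp add: Cons_nth_drop_Suc)
    then have "q = skew_sum (skew_sum_list (take j qs)) (skew_sum (qs ! j) (skew_sum_list (drop (Suc j) qs)))"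
      using split[of j] by (simp add: skew_sum_list_Cons)
    then show ?thesis using that lens(1)[of j] by (simp add: skew_sum_def nth_append)
  qed
  have "skew_blocks q m k P"
  proof
    show "P i < P j" if "i < j" "j \<le> k" for i j
      using that
    proof (induction j)
      case (Suc j)
      then have "0 < length (qs ! j)" using blocks[of j] by simp
      then show ?case using Suc P_Suc[of j] by (cases "i = j") auto
    qed simp
    show "q ! i' < q ! i" if "j \<le> k" "i < P j" "P j \<le> i'" "i' < m" for i i' j
      using skew_sum_nth_less[OF perm(1)[of j] perm(2)[of j], of i i'] lens[of j] split[of j] that by simp
    show "\<exists>i i'. P j \<le> i \<and> i < s \<and> s \<le> i' \<and> i' < P (Suc j) \<and> q ! i < q ! i'"
      if j: "j < k" and s: "P j < s" "s < P (Suc j)" for j s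
    proof -
      have s': "0 < s - P j" "s - P j < length (qs ! j)" using s P_Suc[OF j] by auto
      obtain i i' where i: "i < s - P j" "s - P j \<le> i'" "i' < length (qs ! j)" "qs ! j ! i < qs ! j ! i'"
        using skew_indecomposable_ascent[of "qs ! j" "s - P j"] blocks[OF j] s' by blast
      then have "q ! (P j + i) < q ! (P j + i')" using block_nth[OF j] by simp
      then show ?thesis using i s P_Suc[OF j] by (intro exI[of _ "P j + i"] exI[of _ "P j + i'"]) auto
    qed
    show "P j + 2 \<le> P (Suc j)" if "1 \<le> j" "j < k - 1" for j
    proof -
      have j: "j < k" using that by simp
      have "length (qs ! j) \<noteq> 1"
      proof
        assume "length (qs ! j) = 1"
        then obtain v where "qs ! j = [v]" by (metis One_nat_def length_0_conv length_Suc_conv)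
        moreover have "set (qs ! j) = {1..1}" using blocks[OF j] \<open>length (qs ! j) = 1\<close> is_perm_iff by metis
        ultimately show False using middle[OF that] by simp
      qed
      moreover have "length (qs ! j) \<noteq> 0" using blocks[OF j] by simp
      ultimately show ?thesis using P_Suc[OF j] by linarith
    qed
  qed (use q(1) k Pk in \<open>simp_all add: P_def\<close>)
  then show ?thesis unfolding P_def .
qed

theorem theorem2p2:
  fixes q :: "nat list" and qs :: "nat list list" and m k l r n :: nat
  assumes "q \<in> perms m"
    and "indecomposable q"
    and "k \<ge> 2"
    and "length qs = k"
    and "q = skew_sum_list qs"
    and "\<And>i. i < k \<Longrightarrow> is_perm (qs ! i) \<and> qs ! i \<noteq> [] \<and> skew_indecomposable (qs ! i)"
    and "\<And>i. 1 \<le> i \<Longrightarrow> i < k - 1 \<Longrightarrow> qs ! i \<noteq> [1]"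
    and "l = length (qs ! 0)"
    and "r \<ge> 1"
    and "n \<ge> r * m"
  shows "\<exists>\<phi> :: int set \<times> nat list \<Rightarrow> nat list.
    inj_on \<phi> (ksubsets (int n - int r * int m - int l + 1) r
                \<times> avoiders (int n - int r * int m - int l) q) \<and>
    \<phi> ` (ksubsets (int n - int r * int m - int l + 1) r
                \<times> avoiders (int n - int r * int m - int l) q)
      \<subseteq> perms_with_copies (int n) r q"
proof (cases "r * m + l \<le> n")
  case True
  interpret skew_blocks q m k "\<lambda>j. sum_list (map length (take j qs))"
    by (rule skew_blocks_skew_sum_list[OF assms(1,5,3,4,6,7)])
  define N where "N = n - r * m - l"
  have "int n - int r * int m - int l = int N" "N + l + r * m = n"
    using True by (simp_all add: N_def of_nat_diff)
  then show ?thesis using ksubset_injection[of N r l] by simp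
next
  \<comment> \<open>Here the avoiders would have negative length, so the domain is empty.\<close>
  case False
  then have "int n - int r * int m - int l < 0"
    by (metis diff_diff_add diff_less_0_iff_less not_le of_nat_add of_nat_less_iff of_nat_mult)
  then have "avoiders (int n - int r * int m - int l) q = {}" by (auto simp: avoiders_def)
  then show ?thesis by simp
qed

end
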